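(* Let $k$ and $l$ be nonnegative integers with $k\le l$. The $\mathcal{P}$-positions of the game $\mathcal{W}_{k,l}$ are identical to those of the game $\mathcal{W}_l$.
   Context: All games here are two-player games. A position is a pair $(a,b)$ of nonnegative integers (sizes of two piles of tokens); the piles are unordered, so $(a,b)$ and $(b,a)$ are identified. Players alternate; a player who cannot move loses. For an integer $l\ge 0$, in $\mathcal{W}_l$ each move is one of: (i) remove a positive number of tokens from a single pile; (ii) remove an equal positive number of tokens from both piles, provided that neither pile has size less than $l$ after the move. For nonnegative integers $k\le l$, in $\mathcal{W}_{k,l}$ each move is one of: (i) remove a positive number of tokens from a single pile; (ii) remove an equal positive number of tokens from both piles, provided that the position $(i,j)$ moved to satisfies $\min(i,j)\ge k$ and $\max(i,j)\ge l$. A position is a $\mathcal{P}$-position if the player about to move from it does not have a winning strategy (the previous player wins); equivalently, if no move from it leads to a $\mathcal{P}$-position. *)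

theory Defs
  imports Main "HOL-Library.Uprod"
begin

text \<open>
  A game is given by its move relation: \<open>m p q\<close> says that the player to move at position \<open>p\<close>
  may move to \<open>q\<close>.  The predicate \<open>first_player_wins m p\<close> says that the player about to move
  from \<open>p\<close> can force a win under normal play: some move leads to a position from which every
  reply of the opponent is again winning. If the opponent has no reply, the opponent has lost.
\<close>

inductive first_player_wins :: "('p \<Rightarrow> 'p \<Rightarrow> bool) \<Rightarrow> 'p \<Rightarrow> bool"
  for m :: "'p \<Rightarrow> 'p \<Rightarrow> bool" where
  "m p q \<Longrightarrow> (\<And>r. m q r \<Longrightarrow> first_player_wins m r) \<Longrightarrow> first_player_wins m p"

definition P_positions :: "('p \<Rightarrow> 'p \<Rightarrow> bool) \<Rightarrow> 'p set" where
  "P_positions m = {p. \<not> first_player_wins m p}"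

text \<open>
  Positions are unordered pairs of pile sizes, so \<open>Upair a b = Upair b a\<close>; a single rule
  for removing tokens from one pile therefore covers both piles.
\<close>

inductive W_move :: "nat \<Rightarrow> nat uprod \<Rightarrow> nat uprod \<Rightarrow> bool"
  for l :: nat where
  single: "t > 0 \<Longrightarrow> t \<le> a \<Longrightarrow> W_move l (Upair a b) (Upair (a - t) b)"
| diagonal: "t > 0 \<Longrightarrow> t \<le> a \<Longrightarrow> t \<le> b \<Longrightarrow> a - t \<ge> l \<Longrightarrow> b - t \<ge> l
    \<Longrightarrow> W_move l (Upair a b) (Upair (a - t) (b - t))"

inductive W2_move :: "nat \<Rightarrow> nat \<Rightarrow> nat uprod \<Rightarrow> nat uprod \<Rightarrow> bool"
  for k l :: nat where
  single: "t > 0 \<Longrightarrow> t \<le> a \<Longrightarrow> W2_move k l (Upair a b) (Upair (a - t) b)"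
| diagonal: "t > 0 \<Longrightarrow> t \<le> a \<Longrightarrow> t \<le> b \<Longrightarrow> min (a - t) (b - t) \<ge> k \<Longrightarrow> max (a - t) (b - t) \<ge> l
    \<Longrightarrow> W2_move k l (Upair a b) (Upair (a - t) (b - t))"

text \<open>
  Both games terminate, and hence the P-positions satisfy the usual recursive characterization.
\<close>

lemma P_positions_iff:
  assumes "wfP (\<lambda>q p. m p q)"
  shows "p \<in> P_positions m \<longleftrightarrow> (\<forall>q. m p q \<longrightarrow> q \<notin> P_positions m)"
proof -
  have dich: "first_player_wins m q \<or> (\<forall>r. m q r \<longrightarrow> first_player_wins m r)" for q
    using assms
  proof (induction q rule: wfp_induct_rule)
    case (less q)
    then show ?case by (meson first_player_wins.intros)
  qed
  have "first_player_wins m p \<longleftrightarrow> (\<exists>q. m p q \<and> \<not> first_player_wins m q)"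
  proof
    assume "first_player_wins m p"
    then obtain q where q: "m p q" "\<And>r. m q r \<Longrightarrow> first_player_wins m r"
      by (auto elim: first_player_wins.cases)
    have "\<not> first_player_wins m q"
    proof
      assume "first_player_wins m q"
      from assms this q(2) show False
      proof (induction q rule: wfp_induct_rule)
        case (less q)
        from less.prems(1) obtain r where "m q r" "\<And>s. m r s \<Longrightarrow> first_player_wins m s"
          by (auto elim: first_player_wins.cases)
        with less show False by blast
      qed
    qed
    with q(1) show "\<exists>q. m p q \<and> \<not> first_player_wins m q" by blast
  next
    assume "\<exists>q. m p q \<and> \<not> first_player_wins m q"
    with dich show "first_player_wins m p" by (meson first_player_wins.intros)
  qed
  then show ?thesis by (auto simp: P_positions_def)
qed

lift_definition tokens :: "nat uprod \<Rightarrow> nat" is "\<lambda>(a, b). a + b"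
  by auto

lemma tokens_Upair [simp]: "tokens (Upair a b) = a + b"
  by transfer simp

lemma wfP_W_move: "wfP (\<lambda>q p. W_move l p q)"
  by (rule wfp_if_convertible_to_nat[of _ tokens]) (auto elim!: W_move.cases)

lemma wfP_W2_move: "wfP (\<lambda>q p. W2_move k l p q)"
  by (rule wfp_if_convertible_to_nat[of _ tokens]) (auto elim!: W2_move.cases)

end

theory Submission
  imports Defs
begin

text \<open>
  Every move of \<open>W\<^sub>l\<close> is a move of \<open>W\<^bsub>k,l\<^esub>\<close>, so the two games can only differ
  through the additional diagonal moves, whose targets have one pile smaller than \<open>l\<close> and the
  other at least \<open>l\<close>.  In \<open>W\<^sub>l\<close>, once a pile is smaller than \<open>l\<close>, no diagonal move is possible
  any more and play continues as two-pile Nim, whose P-positions are those with equal piles.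
  Hence the additional moves lead only to positions that are already lost for the player who
  has just moved (\<open>unequal_small_not_P\<close>), and adding such moves to a terminating game does not
  change its P-positions (\<open>P_positions_extra_moves\<close>).
\<close>

text \<open>
  In a terminating game, the P-positions are the unique set (the kernel) that no move joins internally and that can be
  reached in one move from every position outside.  The additional moves preserve both properties
  of the old kernel: they do not end in it, and the old moves into it are still available.
\<close>

lemma P_positions_extra_moves:
  assumes wf: "wfP (\<lambda>q p. m' p q)"
    and sub: "\<And>p q. m p q \<Longrightarrow> m' p q"
    and extra: "\<And>p q. m' p q \<Longrightarrow> \<not> m p q \<Longrightarrow> q \<notin> P_positions m"
  shows "P_positions m' = P_positions m"
proof -
  have wf_m: "wfP (\<lambda>q p. m p q)"
    using wf by (rule wfp_subset) (auto intro: sub)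
  have "p \<in> P_positions m' \<longleftrightarrow> p \<in> P_positions m" for p
    using wf
  proof (induction p rule: wfp_induct_rule)
    case (less p)
    have "p \<in> P_positions m' \<longleftrightarrow> (\<forall>q. m' p q \<longrightarrow> q \<notin> P_positions m)"
      using P_positions_iff[OF wf] less.IH by blast
    also have "\<dots> \<longleftrightarrow> (\<forall>q. m p q \<longrightarrow> q \<notin> P_positions m)"
      using sub extra by blast
    also have "\<dots> \<longleftrightarrow> p \<in> P_positions m"
      using P_positions_iff[OF wf_m] by blast
    finally show ?case .
  qed
  then show ?thesis by blast
qed

lemma Upair_commute: "Upair a b = Upair b a"
  by simp

text \<open>
  The Nim strategy of restoring equality: a move from equal small piles shrinks just one of them,
  and the opponent answers by shrinking the other to the same size.
\<close>

lemma equal_small_P: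
  assumes "a < l"
  shows "Upair a a \<in> P_positions (W_move l)"
  using assms
proof (induction a rule: less_induct)
  case (less a)
  have "q \<notin> P_positions (W_move l)" if move: "W_move l (Upair a a) q" for q
  proof -
    obtain c where c: "c < a" "q = Upair c a"
      using move
    proof cases
      case (single t x y)
      then show ?thesis using that[of "a - t"] by auto
    next
      case (diagonal t x y)
      then show ?thesis using less.prems by auto
    qed
    have "W_move l (Upair a c) (Upair (a - (a - c)) c)"
      using c(1) by (intro W_move.single) auto
    then have "W_move l q (Upair c c)"
      using c by (simp add: Upair_commute)
    moreover have "Upair c c \<in> P_positions (W_move l)"
      using less c(1) by simp
    ultimately show ?thesis
      using P_positions_iff[OF wfP_W_move] by blast
  qed
  then show ?case
    using P_positions_iff[OF wfP_W_move] by blast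
qed

lemma unequal_small_not_P:
  assumes "a < l" "a < b"
  shows "Upair a b \<notin> P_positions (W_move l)"
proof -
  have "W_move l (Upair b a) (Upair (b - (b - a)) a)"
    using assms(2) by (intro W_move.single) auto
  then have "W_move l (Upair a b) (Upair a a)"
    using assms(2) by (simp add: Upair_commute)
  then show ?thesis
    using equal_small_P[OF assms(1)] P_positions_iff[OF wfP_W_move] by blast
qed

lemma W_move_imp_W2_move:
  assumes "k \<le> l" "W_move l p q"
  shows "W2_move k l p q"
  using assms(2)
proof cases
  case (single t a b)
  then show ?thesis by (auto intro: W2_move.single)
next
  case (diagonal t a b)
  then show ?thesis using assms(1) by (auto intro!: W2_move.diagonal)
qed

lemma extra_W2_move_not_P:
  assumes "W2_move k l p q" "\<not> W_move l p q"
  shows "q \<notin> P_positions (W_move l)"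
  using assms(1)
proof cases
  case (single t a b)
  then show ?thesis using assms(2) by (auto intro: W_move.single)
next
  case (diagonal t a b)
  then have "\<not> (l \<le> a - t \<and> l \<le> b - t)"
    using assms(2) W_move.diagonal by blast
  with diagonal(7) consider "a - t < l" "a - t < b - t" | "b - t < l" "b - t < a - t"
    by (auto simp: max_def not_le split: if_splits)
  then show ?thesis
  proof cases
    case 1
    then show ?thesis using diagonal(2) unequal_small_not_P by simp
  next
    case 2
    then have "Upair (b - t) (a - t) \<notin> P_positions (W_move l)"
      by (rule unequal_small_not_P)
    then show ?thesis using diagonal(2) by (simp add: Upair_commute)
  qed
qed

theorem theorem9:
  fixes k l :: nat
  assumes "k \<le> l"
  shows "P_positions (W2_move k l) = P_positions (W_move l)"
  using wfP_W2_move W_move_imp_W2_move[OF assms] extra_W2_move_not_P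
  by (rule P_positions_extra_moves)

end
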